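(* Consider the multi-term fractional initial value problem $\sum_{j=1}^Q\nu_j\,{}_{C}D_{0,t}^{\alpha_j}Y(t)=f(t,Y)$, $t\in(0,T]$, $Y(0)=Y_0$, where $\nu_1>0$, $\nu_j\ge 0$ $(2\le j\le Q)$ and $0<\alpha_{j+1}\le\alpha_j\le1$ $(1\le j<Q)$. If $f(t,Y)=-\lambda Y(t)$ with $\operatorname{Re}(\lambda)>0$, then the numerical method $$\sum_{j=1}^Q \nu_j\,\mathcal{A}_{0,-1}^{\alpha_j,n,m_j}\hat y=f(t_n,y^n),\qquad y^0=Y_0,\qquad \hat y=y-y^0,$$ is unconditionally stable.
   Context: ${}_CD^{\alpha}_{0,t}$ is the Caputo derivative of order $\alpha$ with base point $0$. $\tau>0$ is the time step, $t_n=n\tau$, $y^n$ approximates $Y(t_n)$, and $m_1,\dots,m_Q$ are positive integers. Set $\omega^{(\alpha)}_k=(-1)^k\binom{\alpha}{k}$, $g^{(\alpha)}_{0}=\frac{2+\alpha}{2}\omega^{(\alpha)}_{0}$, $g^{(\alpha)}_{k}=\frac{2+\alpha}{2}\omega^{(\alpha)}_{k}-\frac{\alpha}{2}\omega^{(\alpha)}_{k-1}$ for $k\ge1$; equivalently $$g^{(\alpha)}(z):=\sum_{k\ge0}g^{(\alpha)}_kz^k=(1-z)^{\alpha}\left(1+\tfrac{\alpha}{2}-\tfrac{\alpha}{2}z\right).$$ For a grid function $U$ with $U^k=U(t_k)$, $$\mathcal{A}_{0,-1}^{\alpha,n,m}U=\frac{1}{\tau^{\alpha}}\sum_{k=0}^{n}g^{(\alpha)}_{n-k}U^k+\frac{1}{\tau^{\alpha}}\sum_{k=1}^m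 w_{n,k}^{(\alpha)}U^k,$$ where the starting weights solve $\sum_{k=1}^m w_{n,k}^{(\alpha)}k^{\sigma_r}=\frac{\Gamma(\sigma_r+1)}{\Gamma(\sigma_r+1-\alpha)}n^{\sigma_r-\alpha}-\sum_{k=0}^{n}g^{(\alpha)}_{n-k}k^{\sigma_r}$, $1\le r\le m$, for given exponents $0<\sigma_1<\sigma_2<\cdots$. Stability notion: for the test equation $f(t,Y)=-\lambda Y$, the stability region of the method is $$\mathbb{S}=\mathbb{C}\setminus\Big\{\sum_{j=1}^Q\nu_j\tau^{-\alpha_j}g^{(\alpha_j)}(z)\ :\ |z|\le1,\ \tau>0\Big\},$$ and the method is called unconditionally stable (stable for every $\tau>0$) for the given $\lambda$ if $-\lambda\in\mathbb{S}$. *)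

theory Defs
  imports "HOL-Analysis.Analysis"
begin

record multiterm_ivp =
  mt_Q :: nat
  mt_nu :: "nat \<Rightarrow> real"
  mt_alpha :: "nat \<Rightarrow> real"
  mt_rhs :: "real \<Rightarrow> complex \<Rightarrow> complex"
  mt_T :: real
  mt_Y0 :: complex

text \<open>All indices \<open>j\<close>, \<open>r\<close> and the second index \<open>k\<close> of the starting weights run from \<open>1\<close>.
  \<open>mt_w M j n k\<close> is the weight of the \<open>k\<close>-th grid value in step \<open>n\<close> for the order
  \<open>mt_alpha M j\<close> and \<open>mt_m M j\<close> correction terms.\<close>

record multiterm_method = multiterm_ivp +
  mt_m :: "nat \<Rightarrow> nat"
  mt_sigma :: "nat \<Rightarrow> real"
  mt_w :: "nat \<Rightarrow> nat \<Rightarrow> nat \<Rightarrow> real"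

text \<open>The integral formula only makes sense for \<open>0 < \<alpha> < 1\<close>; for \<open>\<alpha> = 1\<close> the Caputo derivative
  is the ordinary first derivative.\<close>

definition has_caputo_derivative :: "real \<Rightarrow> (real \<Rightarrow> complex) \<Rightarrow> complex \<Rightarrow> real \<Rightarrow> bool" where
  "has_caputo_derivative \<alpha> Y D t \<longleftrightarrow>
     (if \<alpha> = 1 then (Y has_vector_derivative D) (at t within {0..t})
      else (let F = (\<lambda>s. ((t - s) powr (- \<alpha>) / Gamma (1 - \<alpha>)) *\<^sub>R
                          vector_derivative Y (at s within {0..t}))
            in F absolutely_integrable_on {0..t} \<and> D = integral {0..t} F))"

definition solves_multiterm_ivp :: "('a multiterm_ivp_scheme) \<Rightarrow> (real \<Rightarrow> complex) \<Rightarrow> bool" where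
  "solves_multiterm_ivp P Y \<longleftrightarrow>
     Y 0 = mt_Y0 P \<and> continuous_on {0..mt_T P} Y \<and>
     (\<forall>t\<in>{0<..mt_T P}. Y differentiable (at t within {0..mt_T P}) \<and>
        (\<exists>D. (\<forall>j\<in>{1..mt_Q P}. has_caputo_derivative (mt_alpha P j) Y (D j) t) \<and>
             (\<Sum>j=1..mt_Q P. mt_nu P j *\<^sub>R D j) = mt_rhs P t (Y t)))"

definition omega :: "real \<Rightarrow> nat \<Rightarrow> real" where
  "omega \<alpha> k = (-1) ^ k * (\<alpha> gchoose k)"

definition gcoef :: "real \<Rightarrow> nat \<Rightarrow> real" where
  "gcoef \<alpha> k = (if k = 0 then (2 + \<alpha>) / 2 * omega \<alpha> 0
                else (2 + \<alpha>) / 2 * omega \<alpha> k - \<alpha> / 2 * omega \<alpha> (k - 1))"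

text \<open>For \<open>\<alpha> > 0\<close> the series converges absolutely on the whole closed unit disc.\<close>

definition gfun :: "real \<Rightarrow> complex \<Rightarrow> complex" where
  "gfun \<alpha> z = (\<Sum>k. of_real (gcoef \<alpha> k) * z ^ k)"

definition frac_diff ::
    "real \<Rightarrow> real \<Rightarrow> nat \<Rightarrow> (nat \<Rightarrow> nat \<Rightarrow> real) \<Rightarrow> nat \<Rightarrow> (nat \<Rightarrow> complex) \<Rightarrow> complex" where
  "frac_diff \<tau> \<alpha> m w n U =
     (1 / \<tau> powr \<alpha>) *\<^sub>R (\<Sum>k=0..n. gcoef \<alpha> (n - k) *\<^sub>R U k) +
     (1 / \<tau> powr \<alpha>) *\<^sub>R (\<Sum>k=1..m. w n k *\<^sub>R U k)"

definition starting_weights ::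
    "(nat \<Rightarrow> real) \<Rightarrow> real \<Rightarrow> nat \<Rightarrow> (nat \<Rightarrow> nat \<Rightarrow> real) \<Rightarrow> bool" where
  "starting_weights \<sigma> \<alpha> m w \<longleftrightarrow>
     (\<forall>n\<ge>1. \<forall>r\<in>{1..m}.
        (\<Sum>k=1..m. w n k * real k powr \<sigma> r) =
          Gamma (\<sigma> r + 1) / Gamma (\<sigma> r + 1 - \<alpha>) * real n powr (\<sigma> r - \<alpha>)
          - (\<Sum>k=0..n. gcoef \<alpha> (n - k) * real k powr \<sigma> r))"

definition numerical_solution :: "multiterm_method \<Rightarrow> real \<Rightarrow> (nat \<Rightarrow> complex) \<Rightarrow> bool" where
  "numerical_solution M \<tau> y \<longleftrightarrow>
     y 0 = mt_Y0 M \<and>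
     (\<forall>n\<ge>1. real n * \<tau> \<le> mt_T M \<longrightarrow>
        (\<Sum>j=1..mt_Q M. mt_nu M j *\<^sub>R
            frac_diff \<tau> (mt_alpha M j) (mt_m M j) (mt_w M j) n (\<lambda>k. y k - y 0))
        = mt_rhs M (real n * \<tau>) (y n))"

text \<open>The stability region is determined by the generating functions of the convolution part of
  \<^const>\<open>numerical_solution\<close>; the starting weights and the right-hand side do not enter it.\<close>

definition stability_region :: "multiterm_method \<Rightarrow> complex set" where
  "stability_region M =
     UNIV - {(\<Sum>j=1..mt_Q M. of_real (mt_nu M j * \<tau> powr (- mt_alpha M j)) * gfun (mt_alpha M j) z)
              | z \<tau>. norm z \<le> 1 \<and> \<tau> > 0}"

text \<open>The notion is defined for the test equation only; the \<open>\<lambda>\<close> below is unique.\<close>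

definition unconditionally_stable :: "multiterm_method \<Rightarrow> bool" where
  "unconditionally_stable M \<longleftrightarrow>
     (\<exists>lam. (\<forall>t Y. mt_rhs M t Y = - lam * Y) \<and> - lam \<in> stability_region M)"

end

theory Submission imports Defs begin

text \<open>
  The theorem reduces to one property of a single order \<open>0 < \<alpha> \<le> 1\<close>: the generating function
  \<open>g(z) = (1 - z)\<^sup>\<alpha> (1 + \<alpha>/2 - \<alpha>/2 z)\<close> has nonnegative real part on the closed unit disc
  (\<open>Re_gfun_nonneg\<close>). Every point removed from \<open>\<complex>\<close> to form the stability region is a combination
  of values of such functions with nonnegative coefficients \<open>\<nu>\<^sub>j \<tau>\<^bsup>-\<alpha>\<^sub>j\<^esup>\<close>, so it lies in the closed right
  half plane, whereas \<open>-\<lambda>\<close> lies in the open left half plane.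

  For the property itself, put \<open>w = 1 - z = r e\<^bsup>i\<theta>\<^esup>\<close>, so that \<open>g = w\<^sup>\<alpha> (1 + \<alpha>/2 w)\<close> and
  \<open>Re g = r\<^sup>\<alpha> (cos \<alpha>\<theta> + \<alpha>/2 r cos (1 + \<alpha>)\<theta>)\<close>. The disc \<open>|1 - w| \<le> 1\<close> is given by
  \<open>r \<le> 2 cos \<theta>\<close>. The bracket is affine in \<open>r\<close> and nonnegative at \<open>r = 0\<close>, so only the endpoint
  \<open>r = 2 cos \<theta>\<close> matters, where it becomes \<open>cos \<alpha>\<theta> + \<alpha> cos \<theta> cos (1 + \<alpha>)\<theta>\<close>. This is
  nonnegative because the only negative contribution, \<open>\<alpha> cos \<theta> sin \<theta> sin \<alpha>\<theta>\<close>, is at most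
  \<open>cos \<theta> \<le> cos \<alpha>\<theta>\<close>.

  The closed form of \<open>g\<close> comes from the binomial series and is valid in the open disc. The boundary
  circle is reached by continuity, because the power series converges absolutely and uniformly on
  the closed disc.
\<close>

section \<open>Absolute convergence on the closed disc\<close>

lemma omega_0 [simp]: "omega \<alpha> 0 = 1"
  by (simp add: omega_def)

lemma omega_Suc: "omega \<alpha> (Suc k) = omega \<alpha> k * ((real k - \<alpha>) / (real k + 1))"
proof -
  have "(\<alpha> gchoose Suc k) = (\<alpha> gchoose k) * ((\<alpha> - real k) / (real k + 1))"
    using gbinomial_mult_1[of \<alpha> k] by (simp add: field_simps)
  moreover have "(real k - \<alpha>) / (real k + 1) = - ((\<alpha> - real k) / (real k + 1))"
    by (simp add: diff_divide_distrib)
  ultimately show ?thesis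
    by (simp add: omega_def)
qed

lemma omega_nonneg: "\<alpha> \<le> 0 \<Longrightarrow> omega \<alpha> k \<ge> 0"
  by (induction k) (auto simp: omega_Suc)

lemma omega_Suc_nonpos:
  assumes "0 \<le> \<alpha>" "\<alpha> \<le> 1"
  shows "omega \<alpha> (Suc k) \<le> 0"
proof (induction k)
  case 0
  then show ?case using assms by (simp add: omega_Suc)
next
  case (Suc k)
  then show ?case
    using assms by (subst omega_Suc) (intro mult_nonpos_nonneg, auto)
qed

lemma sum_omega: "(\<Sum>k\<le>n. omega \<alpha> k) = omega (\<alpha> - 1) n"
  using gbinomial_sum_lower_neg[of \<alpha> n] by (simp add: omega_def mult.commute)

text \<open>Only \<open>\<omega>\<^sub>0 = 1\<close> is positive, so the partial sums of \<open>|\<omega>\<^sub>k|\<close> are \<open>2\<close> minus those of \<open>\<omega>\<^sub>k\<close>. The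
  latter are the coefficients \<open>\<omega>\<close> of order \<open>\<alpha> - 1 \<le> 0\<close>, hence nonnegative, which bounds
  the former by \<open>2\<close>.\<close>

lemma summable_abs_omega:
  assumes "0 \<le> \<alpha>" "\<alpha> \<le> 1"
  shows "summable (\<lambda>k. \<bar>omega \<alpha> k\<bar>)"
proof (rule bounded_imp_summable)
  fix n
  have "(\<Sum>k\<le>n. \<bar>omega \<alpha> k\<bar>) = 2 - (\<Sum>k\<le>n. omega \<alpha> k)"
  proof (induction n)
    case (Suc n)
    then show ?case
      using omega_Suc_nonpos[OF assms, of n] by simp
  qed simp
  then show "(\<Sum>k\<le>n. \<bar>omega \<alpha> k\<bar>) \<le> 2"
    using omega_nonneg[of "\<alpha> - 1" n] assms by (simp add: sum_omega)
qed simp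

lemma summable_abs_gcoef:
  assumes "0 \<le> \<alpha>" "\<alpha> \<le> 1"
  shows "summable (\<lambda>k. \<bar>gcoef \<alpha> k\<bar>)"
proof -
  note s = summable_abs_omega[OF assms]
  have "summable (\<lambda>k. (2 + \<alpha>) / 2 * \<bar>omega \<alpha> (Suc k)\<bar> + \<alpha> / 2 * \<bar>omega \<alpha> k\<bar>)"
    using s summable_Suc_iff[of "\<lambda>k. \<bar>omega \<alpha> k\<bar>"]
    by (intro summable_add summable_mult) auto
  moreover have "norm \<bar>gcoef \<alpha> (Suc k)\<bar> \<le>
      (2 + \<alpha>) / 2 * \<bar>omega \<alpha> (Suc k)\<bar> + \<alpha> / 2 * \<bar>omega \<alpha> k\<bar>" for k
    using abs_triangle_ineq4[of "(2 + \<alpha>) / 2 * omega \<alpha> (Suc k)" "\<alpha> / 2 * omega \<alpha> k"] assms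
    by (simp add: gcoef_def abs_mult)
  ultimately have "summable (\<lambda>k. \<bar>gcoef \<alpha> (Suc k)\<bar>)"
    by (rule summable_comparison_test'[where N = 0])
  then show ?thesis
    by (subst (asm) summable_Suc_iff)
qed

lemma continuous_on_gfun:
  assumes "0 \<le> \<alpha>" "\<alpha> \<le> 1"
  shows "continuous_on (cball 0 1) (gfun \<alpha>)"
proof -
  have lim: "uniform_limit (cball 0 1) (\<lambda>n z. \<Sum>k<n. of_real (gcoef \<alpha> k) * z ^ k) (gfun \<alpha>) sequentially"
    unfolding gfun_def
  proof (rule Weierstrass_m_test)
    fix n and z :: complex assume "z \<in> cball 0 1"
    then show "norm (of_real (gcoef \<alpha> n) * z ^ n) \<le> \<bar>gcoef \<alpha> n\<bar>"
      by (simp add: norm_mult norm_power mult_left_le power_le_one)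
  qed (rule summable_abs_gcoef[OF assms])
  have "continuous_on (cball 0 1) (\<lambda>z. \<Sum>k<n. of_real (gcoef \<alpha> k) * z ^ k :: complex)" for n
    by (intro continuous_intros)
  then have "\<forall>\<^sub>F n in sequentially. continuous_on (cball 0 1)
      (\<lambda>z. \<Sum>k<n. of_real (gcoef \<alpha> k) * z ^ k :: complex)"
    by (rule eventuallyI)
  from uniform_limit_theorem[OF this lim trivial_limit_sequentially] show ?thesis .
qed

section \<open>The closed form in the open disc\<close>

lemma omega_power_sums:
  fixes z :: complex
  assumes "norm z < 1"
  shows "(\<lambda>k. of_real (omega \<alpha> k) * z ^ k) sums ((1 - z) powr of_real \<alpha>)"
proof -
  have "of_real (\<alpha> gchoose k) = ((of_real \<alpha> :: complex) gchoose k)" for k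
    by (simp add: gbinomial_prod_rev)
  moreover have "(\<lambda>k. (of_real \<alpha> gchoose k) * (- z) ^ k) sums ((1 - z) powr of_real \<alpha>)"
    using gen_binomial_complex[of "- z" "of_real \<alpha>"] assms by simp
  ultimately show ?thesis
    by (simp add: omega_def power_minus[of z] mult_ac)
qed

text \<open>Each \<open>g\<^sub>k\<close> combines \<open>\<omega>\<^sub>k\<close> with the shifted \<open>\<omega>\<^bsub>k-1\<^esub>\<close>, so \<open>g\<close> is the binomial series times
  \<open>(2 + \<alpha>)/2 - \<alpha>/2 z\<close>. That factor is written in terms of \<open>w = 1 - z\<close> as \<open>1 + \<alpha>/2 w\<close>, so that the
  whole function depends on \<open>w\<close> alone.\<close>

lemma gfun_closed_form:
  assumes "norm z < 1"
  shows "gfun \<alpha> z = (1 - z) powr of_real \<alpha> * (1 + of_real (\<alpha> / 2) * (1 - z))"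
proof -
  define S where "S = (1 - z) powr complex_of_real \<alpha>"
  have S: "(\<lambda>k. of_real (omega \<alpha> k) * z ^ k) sums S"
    unfolding S_def by (rule omega_power_sums[OF assms])
  \<comment> \<open>The terms of the series of \<open>z * S\<close>; the value at \<open>0\<close> matches the separate clause for \<open>g\<^sub>0\<close>.\<close>
  define T where "T k = (case k of 0 \<Rightarrow> 0 | Suc j \<Rightarrow> of_real (omega \<alpha> j) * z ^ Suc j)" for k
  have "(\<lambda>k. T (Suc k)) sums (z * S)"
    using sums_mult[OF S, of z] by (simp add: T_def mult_ac)
  then have "T sums (z * S + T 0)"
    by (rule sums_Suc)
  then have "T sums (z * S)"
    by (simp add: T_def)
  from sums_diff[OF sums_mult[OF S] sums_mult[OF this]]
  have "(\<lambda>k. of_real ((2 + \<alpha>) / 2) * (of_real (omega \<alpha> k) * z ^ k) - of_real (\<alpha> / 2) * T k) sums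
          (of_real ((2 + \<alpha>) / 2) * S - of_real (\<alpha> / 2) * (z * S))" .
  moreover have "of_real ((2 + \<alpha>) / 2) * (of_real (omega \<alpha> k) * z ^ k) - of_real (\<alpha> / 2) * T k =
      of_real (gcoef \<alpha> k) * z ^ k" for k
    by (cases k) (simp_all add: T_def gcoef_def left_diff_distrib mult.assoc)
  ultimately have "(\<lambda>k. of_real (gcoef \<alpha> k) * z ^ k) sums
          (of_real ((2 + \<alpha>) / 2) * S - of_real (\<alpha> / 2) * (z * S))"
    by simp
  then have "gfun \<alpha> z = of_real ((2 + \<alpha>) / 2) * S - of_real (\<alpha> / 2) * (z * S)"
    unfolding gfun_def by (rule sums_unique[symmetric])
  also have "\<dots> = S * (1 + of_real (\<alpha> / 2) * (1 - z))"
    by (simp add: field_simps)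
  finally show ?thesis
    unfolding S_def .
qed

section \<open>Nonnegativity of the real part\<close>

text \<open>The bound behind this is \<open>|\<alpha> sin \<theta> sin \<alpha>\<theta>| \<le> 1\<close> together with \<open>cos \<theta> \<le> cos \<alpha>\<theta>\<close>, which holds
  since \<open>|\<alpha>\<theta>| \<le> |\<theta>|\<close>. The expression is the value of the bracket at the endpoint \<open>r = 2 cos \<theta>\<close>, that is, on the unit circle.\<close>

lemma cos_plus_cos_mult_cos_nonneg:
  fixes \<alpha> \<theta> :: real
  assumes "0 \<le> \<alpha>" "\<alpha> \<le> 1" "\<bar>\<theta>\<bar> \<le> pi / 2"
  shows "cos (\<alpha> * \<theta>) + \<alpha> * cos \<theta> * cos ((1 + \<alpha>) * \<theta>) \<ge> 0"
proof -
  have le: "\<bar>\<alpha> * \<theta>\<bar> \<le> \<bar>\<theta>\<bar>"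
    using assms by (simp add: abs_mult mult_left_le_one_le)
  have c0: "cos \<theta> \<ge> 0"
    using assms by (intro cos_ge_zero) auto
  have "cos \<bar>\<theta>\<bar> \<le> cos \<bar>\<alpha> * \<theta>\<bar>"
    using le assms by (intro cos_monotone_0_pi_le) auto
  then have c: "cos \<theta> \<le> cos (\<alpha> * \<theta>)"
    by simp
  have "\<bar>\<alpha> * (sin \<theta> * sin (\<alpha> * \<theta>))\<bar> \<le> 1 * (1 * 1)"
    unfolding abs_mult using assms by (intro mult_mono) auto
  then have le_c: "cos \<theta> * (\<alpha> * (sin \<theta> * sin (\<alpha> * \<theta>))) \<le> cos \<theta>"
    using c0 by (intro mult_left_le) auto
  have nonneg: "\<alpha> * cos \<theta> * (cos \<theta> * cos (\<alpha> * \<theta>)) \<ge> 0"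
    using assms c0 c by auto
  have sum: "cos ((1 + \<alpha>) * \<theta>) = cos \<theta> * cos (\<alpha> * \<theta>) - sin \<theta> * sin (\<alpha> * \<theta>)"
    by (simp add: distrib_right cos_add)
  show ?thesis
    unfolding sum using c nonneg le_c by (simp add: algebra_simps)
qed

text \<open>This holds on the closed disc \<open>|1 - w| \<le> 1\<close>, which meets the branch cut of \<open>w\<^sup>\<alpha>\<close> only at
  \<open>w = 0\<close>. Away from that point \<open>|\<theta>| < \<pi>/2\<close>, and writing \<open>w\<^sup>\<alpha>\<close> and \<open>w\<^bsup>1+\<alpha>\<^esup>\<close> as exponentials of
  \<open>Ln w\<close> exhibits the real part as \<open>r\<^sup>\<alpha>\<close> times the bracket.\<close>

lemma Re_powr_mult_affine_nonneg:
  fixes w :: complex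
  assumes \<alpha>: "0 \<le> \<alpha>" "\<alpha> \<le> 1" and w: "norm (1 - w) \<le> 1"
  shows "Re (w powr of_real \<alpha> * (1 + of_real (\<alpha> / 2) * w)) \<ge> 0"
proof (cases "w = 0")
  case False
  define r where "r = norm w"
  define \<theta> where "\<theta> = Im (Ln w)"
  have r: "r > 0" using False by (simp add: r_def)
  have exp_Re: "exp (Re (Ln w)) = r"
    using False by (simp add: r_def)
  have w_exp: "w = exp (Ln w)"
    using False by simp
  have Re_w: "Re w = r * cos \<theta>"
    by (subst w_exp) (simp only: Re_exp exp_Re \<theta>_def)
  \<comment> \<open>Expanding \<open>|1 - w|\<^sup>2 \<le> 1\<close> and cancelling \<open>r\<close> gives the polar form \<open>r \<le> 2 cos \<theta>\<close> of the disc.\<close>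
  have "r\<^sup>2 \<le> 2 * Re w"
  proof -
    have "(norm (1 - w))\<^sup>2 \<le> 1"
      using w by (simp add: power_le_one)
    then show ?thesis
      unfolding r_def cmod_power2 by (simp add: power2_eq_square algebra_simps)
  qed
  then have "r * r \<le> r * (2 * cos \<theta>)"
    by (simp add: Re_w power2_eq_square)
  then have r_le: "r \<le> 2 * cos \<theta>"
    using r by simp
  have "Re w > 0"
    using r r_le by (simp add: Re_w)
  then have \<theta>: "\<bar>\<theta>\<bar> < pi / 2"
    using Re_Ln_pos_lt[OF False] by (simp add: \<theta>_def)
  have bracket: "cos (\<alpha> * \<theta>) + \<alpha> / 2 * r * cos ((1 + \<alpha>) * \<theta>) \<ge> 0"
  proof (cases "cos ((1 + \<alpha>) * \<theta>) \<ge> 0")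
    case True
    have "\<bar>\<alpha> * \<theta>\<bar> \<le> \<bar>\<theta>\<bar>"
      using \<alpha> by (simp add: abs_mult mult_left_le_one_le)
    then have "cos (\<alpha> * \<theta>) \<ge> 0"
      using \<theta> by (intro cos_ge_zero) auto
    then show ?thesis
      using True \<alpha> r by simp
  next
    case False
    \<comment> \<open>The bracket decreases in \<open>r\<close>, so its value at the largest radius is a lower bound.\<close>
    have "\<alpha> / 2 * (2 * cos \<theta>) * cos ((1 + \<alpha>) * \<theta>) \<le> \<alpha> / 2 * r * cos ((1 + \<alpha>) * \<theta>)"
      using False \<alpha> r_le by (intro mult_right_mono_neg mult_left_mono) auto
    then show ?thesis
      using cos_plus_cos_mult_cos_nonneg[OF \<alpha>, of \<theta>] \<theta> by simp
  qed
  have powr: "w powr of_real \<alpha> = exp (of_real \<alpha> * Ln w)"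
    using False by (simp add: powr_def)
  have "w powr of_real \<alpha> * (1 + of_real (\<alpha> / 2) * w) =
          exp (of_real \<alpha> * Ln w) + of_real (\<alpha> / 2) * exp (of_real (1 + \<alpha>) * Ln w)"
  proof -
    have "exp (of_real \<alpha> * Ln w) * w = exp (of_real (1 + \<alpha>) * Ln w)"
      using False by (simp add: ring_distribs exp_add mult_ac)
    then show ?thesis
      unfolding powr by (simp add: algebra_simps)
  qed
  moreover have "Re (exp (of_real a * Ln w)) = exp (a * Re (Ln w)) * cos (a * \<theta>)" for a
    by (simp add: Re_exp \<theta>_def)
  moreover have "exp ((1 + \<alpha>) * Re (Ln w)) = exp (\<alpha> * Re (Ln w)) * r"
    unfolding exp_Re[symmetric] by (simp add: exp_add[symmetric] algebra_simps)
  moreover have "Re (of_real c * u) = c * Re u" for c u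
    by simp
  ultimately have "Re (w powr of_real \<alpha> * (1 + of_real (\<alpha> / 2) * w)) =
      exp (\<alpha> * Re (Ln w)) * (cos (\<alpha> * \<theta>) + \<alpha> / 2 * r * cos ((1 + \<alpha>) * \<theta>))"
    by (simp only: plus_complex.sel) (simp add: algebra_simps)
  then show ?thesis
    using bracket by simp
qed simp

text \<open>The closed form gives the bound for \<open>|z| < 1\<close>, and continuity on the closed disc carries it over
  to the unit circle.\<close>

lemma Re_gfun_nonneg:
  assumes "0 \<le> \<alpha>" "\<alpha> \<le> 1" "norm z \<le> 1"
  shows "Re (gfun \<alpha> z) \<ge> 0"
proof (rule continuous_ge_on_closure[where S = "ball 0 1" and f = "\<lambda>z. Re (gfun \<alpha> z)"])
  show "continuous_on (closure (ball 0 1)) (\<lambda>z. Re (gfun \<alpha> z))"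
    using continuous_on_gfun[OF assms(1,2)] by (simp add: continuous_on_Re)
next
  show "z \<in> closure (ball 0 1)"
    using assms(3) by simp
next
  fix u :: complex assume "u \<in> ball 0 1"
  then show "Re (gfun \<alpha> u) \<ge> 0"
    using Re_powr_mult_affine_nonneg[OF assms(1,2), of "1 - u"] by (simp add: gfun_closed_form)
qed

section \<open>Unconditional stability\<close>

theorem theorem3p1:
  fixes M :: multiterm_method and lam :: complex
  assumes "mt_T M > 0"
    and "mt_Q M \<ge> 1"
    and "mt_nu M 1 > 0"
    and "\<And>j. 2 \<le> j \<Longrightarrow> j \<le> mt_Q M \<Longrightarrow> mt_nu M j \<ge> 0"
    and "\<And>j. 1 \<le> j \<Longrightarrow> j \<le> mt_Q M \<Longrightarrow> 0 < mt_alpha M j \<and> mt_alpha M j \<le> 1"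
    and "\<And>j. 1 \<le> j \<Longrightarrow> j < mt_Q M \<Longrightarrow> mt_alpha M (j + 1) \<le> mt_alpha M j"
    and "\<And>j. 1 \<le> j \<Longrightarrow> j \<le> mt_Q M \<Longrightarrow> mt_m M j > 0"
    and "mt_sigma M 1 > 0"
    and "\<And>r. 1 \<le> r \<Longrightarrow> mt_sigma M r < mt_sigma M (r + 1)"
    and "\<And>j. 1 \<le> j \<Longrightarrow> j \<le> mt_Q M \<Longrightarrow>
           starting_weights (mt_sigma M) (mt_alpha M j) (mt_m M j) (mt_w M j)"
    and "\<And>t Y. mt_rhs M t Y = - lam * Y"
    and "Re lam > 0"
  shows "unconditionally_stable M"
proof -
  have "- lam \<in> stability_region M"
    unfolding stability_region_def
  proof (clarsimp)
    fix z :: complex and \<tau> :: real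
    assume z: "norm z \<le> 1" and "\<tau> > 0"
      and eq: "- lam = (\<Sum>j = Suc 0..mt_Q M. of_real (mt_nu M j) * of_real (\<tau> powr (- mt_alpha M j)) * gfun (mt_alpha M j) z)"
    have "Re (of_real (mt_nu M j) * of_real (\<tau> powr (- mt_alpha M j)) * gfun (mt_alpha M j) z) \<ge> 0"
      if "j \<in> {Suc 0..mt_Q M}" for j
    proof -
      have "mt_nu M j \<ge> 0"
        using assms(3) assms(4)[of j] that by (cases "j = 1") auto
      moreover have "Re (gfun (mt_alpha M j) z) \<ge> 0"
        using assms(5)[of j] that z by (intro Re_gfun_nonneg) auto
      ultimately show ?thesis
        by (simp flip: of_real_mult)
    qed
    then have "Re (- lam) \<ge> 0"
      unfolding eq Re_sum by (rule sum_nonneg)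
    then show False
      using assms(12) by simp
  qed
  then show ?thesis
    unfolding unconditionally_stable_def using assms(11) by blast
qed

end
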